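(* Let $d>0$, let $L$ be a finite set, and for each $\ell\in L$ let $I_\ell=[a_\ell,b_\ell]$ be a closed bounded interval of the real line (possibly empty). Suppose that the 2-interval covering problem for the edge $[0,d]$ with these intervals is feasible. Then the greedy algorithm described in the context is optimal for it: the algorithm terminates with a set $L_1\subseteq L$ such that every point of $[0,d]$ belongs to $I_\ell$ for at least two distinct $\ell\in L_1$, and $|L_1|\le |L'|$ for every $L'\subseteq L$ such that every point of $[0,d]$ belongs to $I_\ell$ for at least two distinct $\ell\in L'$.
   Context: **2-interval covering problem.** Given $d>0$, a finite index set $L$ and closed bounded intervals $I_\ell=[a_\ell,b_\ell]$ ($\ell\in L$; some may be empty), a subset $L'\subseteq L$ is feasible if every point $x\in[0,d]$ satisfies $x\in I_\ell$ for at least two distinct indices $\ell\in L'$. The problem asks for a feasible subset of minimum cardinality; the instance is feasible if some feasible subset exists. Intervals are distinguished by their index, so two indices with equal intervals count as two intervals. (In the application, $[0,d]$ is an edge of a vehicle's path, and $I_\ell$ is the part of the edge on which a landmark placed at $\ell$ is visible.) **Greedy algorithm.** It maintains a set $I\subseteq L$ of unused indices, an output set $L_1$, and reals $c\le c_1$. Ties are broken arbitrarily, and "$I_\ell$ covers $c$" means $c\in I_\ell$. 1. Set $I\leftarrow L$ (indices of empty intervals never get used), $L_1\leftarrow\emptyset$, $c\leftarrow 0$. 2. Let $\hat L\subseteq I$ consist of two indices whose intervals contain $c=0$ and have the largest and second largest right endpoints $b_\ell$ among all intervals containing $0$. 3. Set $c\leftarrow\min\{b_\ell:\ell\in\hat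 L\}$, $c_1\leftarrow\max\{b_\ell:\ell\in\hat L\}$, $L_1\leftarrow L_1\cup\hat L$, $I\leftarrow I\setminus\hat L$. 4. While $c<d$: - choose $\ell_1\in I$ maximizing $b_\ell$ among all $\ell\in I$ with $c\in I_\ell$; if there is no such $\ell$, exit and report that the problem is infeasible; - set $L_1\leftarrow L_1\cup\{\ell_1\}$ and $I\leftarrow I\setminus\{\ell_1\}$; - simultaneously set $c\leftarrow\min(c_1,b_{\ell_1})$ and $c_1\leftarrow\max(c_1,b_{\ell_1})$ (both right-hand sides use the old value of $c_1$). 5. Output $L_1$. *)

theory Defs
  imports Complex_Main
begin

definition twice_covered :: "('l \<Rightarrow> real) \<Rightarrow> ('l \<Rightarrow> real) \<Rightarrow> 'l set \<Rightarrow> real \<Rightarrow> bool" where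
  "twice_covered a b L' x \<longleftrightarrow>
     (\<exists>l\<in>L'. \<exists>m\<in>L'. l \<noteq> m \<and> x \<in> {a l..b l} \<and> x \<in> {a m..b m})"

definition feasible_cover ::
  "real \<Rightarrow> 'l set \<Rightarrow> ('l \<Rightarrow> real) \<Rightarrow> ('l \<Rightarrow> real) \<Rightarrow> 'l set \<Rightarrow> bool" where
  "feasible_cover d L a b L' \<longleftrightarrow> L' \<subseteq> L \<and> (\<forall>x\<in>{0..d}. twice_covered a b L' x)"

definition feasible_instance ::
  "real \<Rightarrow> 'l set \<Rightarrow> ('l \<Rightarrow> real) \<Rightarrow> ('l \<Rightarrow> real) \<Rightarrow> bool" where
  "feasible_instance d L a b \<longleftrightarrow> (\<exists>L'. feasible_cover d L a b L')"

definition optimal_cover ::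
  "real \<Rightarrow> 'l set \<Rightarrow> ('l \<Rightarrow> real) \<Rightarrow> ('l \<Rightarrow> real) \<Rightarrow> 'l set \<Rightarrow> bool" where
  "optimal_cover d L a b L' \<longleftrightarrow>
     feasible_cover d L a b L' \<and> (\<forall>M. feasible_cover d L a b M \<longrightarrow> card L' \<le> card M)"

text \<open>
  The greedy algorithm is a transition relation between configurations, since ties are broken
  arbitrarily. \<open>Loop I L\<^sub>1 c c\<^sub>1\<close> is the state at the head of the while loop: the unused indices,
  the output set under construction, and the two reals. \<open>Start\<close> has no successor when fewer
  than two intervals contain 0; such a run is stuck without producing an output.
\<close>

datatype 'l config =
    Start
  | Loop "'l set" "'l set" real real
  | Output "'l set"
  | Infeasible

definition best_index ::
  "('l \<Rightarrow> real) \<Rightarrow> ('l \<Rightarrow> real) \<Rightarrow> 'l set \<Rightarrow> real \<Rightarrow> 'l \<Rightarrow> bool" where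
  "best_index a b I c = is_arg_max b (\<lambda>l. l \<in> I \<and> c \<in> {a l..b l})"

inductive greedy_step ::
  "real \<Rightarrow> 'l set \<Rightarrow> ('l \<Rightarrow> real) \<Rightarrow> ('l \<Rightarrow> real) \<Rightarrow> 'l config \<Rightarrow> 'l config \<Rightarrow> bool"
  for d :: real and L :: "'l set" and a b :: "'l \<Rightarrow> real" where
  init:
    "best_index a b L 0 p \<Longrightarrow> best_index a b (L - {p}) 0 q \<Longrightarrow>
     greedy_step d L a b Start
       (Loop (L - {p, q}) {p, q} (min (b p) (b q)) (max (b p) (b q)))"
| extend:
    "c < d \<Longrightarrow> best_index a b I c l \<Longrightarrow>
     greedy_step d L a b (Loop I L1 c c1)
       (Loop (I - {l}) (L1 \<union> {l}) (min c1 (b l)) (max c1 (b l)))"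
| fail:
    "c < d \<Longrightarrow> \<not> (\<exists>l\<in>I. c \<in> {a l..b l}) \<Longrightarrow>
     greedy_step d L a b (Loop I L1 c c1) Infeasible"
| finish:
    "\<not> c < d \<Longrightarrow> greedy_step d L a b (Loop I L1 c c1) (Output L1)"

text \<open>
  Every run from \<open>Start\<close> is finite, and whenever a run cannot be continued it has ended in an
  output satisfying \<open>P\<close>. In particular at least one output is produced.
\<close>

definition greedy_terminates_with ::
  "real \<Rightarrow> 'l set \<Rightarrow> ('l \<Rightarrow> real) \<Rightarrow> ('l \<Rightarrow> real) \<Rightarrow> ('l set \<Rightarrow> bool) \<Rightarrow> bool" where
  "greedy_terminates_with d L a b P \<longleftrightarrow>
     \<not> (\<exists>r :: nat \<Rightarrow> 'l config. r 0 = Start \<and> (\<forall>i. greedy_step d L a b (r i) (r (Suc i)))) \<and>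
     (\<forall>s. (greedy_step d L a b)\<^sup>*\<^sup>* Start s \<and> \<not> (\<exists>t. greedy_step d L a b s t) \<longrightarrow>
          (\<exists>L1. s = Output L1 \<and> P L1))"

end

theory Submission imports Defs begin

text \<open>
  Every intermediate output set extends to an optimal cover. The set built so far covers
  \<open>[0, c]\<close> twice and contains at most one interval reaching beyond \<open>c\<close>, so any cover extending it
  contains an unused interval through \<open>c\<close>. Exchanging that interval for the greedy choice, which
  reaches at least as far to the right, preserves feasibility and cardinality.
\<close>

section \<open>Double coverage, greedy choices and the existence of an optimal cover\<close>

lemma twice_covered_mono:
  "twice_covered a b A x \<Longrightarrow> A \<subseteq> B \<Longrightarrow> twice_covered a b B x"
  unfolding twice_covered_def by blast

lemma twice_coveredE_other:
  assumes "twice_covered a b M x"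
  obtains m where "m \<in> M" "m \<noteq> p" "x \<in> {a m..b m}"
  using assms unfolding twice_covered_def by metis

lemma best_indexD:
  assumes "best_index a b I c l"
  shows "l \<in> I" "c \<in> {a l..b l}"
    and "\<And>m. m \<in> I \<Longrightarrow> c \<in> {a m..b m} \<Longrightarrow> b m \<le> b l"
  using assms unfolding best_index_def is_arg_max_def by (auto simp: not_less)

lemma best_index_exists:
  assumes "finite I" "m \<in> I" "c \<in> {a m..b m}"
  shows "\<exists>l. best_index a b I c l"
proof -
  \<comment> \<open>Maximizing \<open>b\<close> is minimizing \<open>- b\<close>, and a minimum
    exists on a finite nonempty set.\<close>
  have "\<exists>l. is_arg_min (\<lambda>l. - b l) (\<lambda>l. l \<in> {l \<in> I. c \<in> {a l..b l}}) l"
    using assms by (intro ex_is_arg_min_if_finite) auto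
  then show ?thesis
    by (simp add: best_index_def is_arg_max_def is_arg_min_def)
qed

lemma optimal_cover_exists:
  assumes "feasible_instance d L a b"
  shows "\<exists>M. optimal_cover d L a b M"
proof -
  obtain N where "feasible_cover d L a b N"
    using assms unfolding feasible_instance_def by blast
  from ex_has_least_nat[of "feasible_cover d L a b", OF this, of card]
  show ?thesis
    unfolding optimal_cover_def by blast
qed

section \<open>The exchange argument\<close>

text \<open>Coverage at \<open>c\<close> alone would allow intervals ending at \<open>c\<close>. A
  point slightly to the right of \<open>c\<close>, before the next left endpoint, is covered by an
  interval other than \<open>p\<close>, and that interval must already have begun by
  \<open>c\<close>.\<close>

lemma twice_covered_beyond:
  assumes "finite M" "\<forall>x\<in>{0..d}. twice_covered a b M x" "0 \<le> c" "c < d"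
  obtains m where "m \<in> M" "m \<noteq> p" "c \<in> {a m..b m}" "c < b m"
proof -
  \<comment> \<open>The next left endpoint of \<open>M\<close> beyond \<open>c\<close>, capped at
    \<open>d\<close> so that the minimum is over a nonempty set and points below \<open>e\<close>
    stay in the edge.\<close>
  define e where "e = Min (insert d {a l | l. l \<in> M \<and> c < a l})"
  have fin: "finite (insert d {a l | l. l \<in> M \<and> c < a l})"
    using assms(1) by simp
  have "c < e" "e \<le> d"
    unfolding e_def using fin assms(4) by (auto simp: Min_gr_iff)
  have e: "a m \<le> c" if "m \<in> M" "a m < e" for m
  proof (rule ccontr)
    assume "\<not> a m \<le> c"
    then have "e \<le> a m"
      unfolding e_def using that(1) fin by (intro Min_le) auto
    with that(2) show False by simp
  qed
  obtain x where x: "c < x" "x < e"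
    using \<open>c < e\<close> dense by blast
  have "twice_covered a b M x"
    using assms x \<open>e \<le> d\<close> by simp
  then obtain m where "m \<in> M" "m \<noteq> p" "x \<in> {a m..b m}"
    by (rule twice_coveredE_other)
  with x e[of m] show ?thesis
    by (intro that[of m]) auto
qed

text \<open>Replace \<open>m\<close> by \<open>l\<close>. Left of \<open>c\<close> the set
  \<open>L1\<close> suffices; from \<open>c\<close> on, \<open>l\<close> covers whatever
  \<open>m\<close> covers, because it contains \<open>c\<close> and \<open>b m \<le> b l\<close>.
  Coverage by \<open>L1\<close> is required only strictly left of \<open>c\<close>, so at
  \<open>c = 0\<close> it holds vacuously.\<close>

lemma optimal_cover_exchange:
  assumes "finite L" and opt: "optimal_cover d L a b M"
    and "L1 \<subseteq> M" and cov: "\<And>x. 0 \<le> x \<Longrightarrow> x < c \<Longrightarrow> twice_covered a b L1 x"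
    and l: "best_index a b (L - L1) c l"
    and m: "m \<in> M" "m \<notin> L1" "c \<in> {a m..b m}"
  shows "\<exists>M'. optimal_cover d L a b M' \<and> insert l L1 \<subseteq> M'"
proof (cases "l \<in> M")
  case True
  with opt \<open>L1 \<subseteq> M\<close> show ?thesis by blast
next
  case False
  define M' where "M' = insert l (M - {m})"
  have M: "M \<subseteq> L" "\<And>x. x \<in> {0..d} \<Longrightarrow> twice_covered a b M x"
    using opt unfolding optimal_cover_def feasible_cover_def by auto
  then have "finite M"
    using \<open>finite L\<close> finite_subset by blast
  have "b m \<le> b l"
    using best_indexD(3)[OF l] m M(1) by blast
  have "L1 \<subseteq> M'"
    using \<open>L1 \<subseteq> M\<close> m(2) unfolding M'_def by blast
  have cov': "twice_covered a b M' x" if x: "x \<in> {0..d}" for x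
  proof (cases "x < c")
    case True
    then show ?thesis
      using cov[of x] x \<open>L1 \<subseteq> M'\<close> by (auto intro: twice_covered_mono)
  next
    case x_ge: False
    have repl: "x \<in> {a l..b l}" if "x \<in> {a m..b m}"
      using that x_ge best_indexD(2)[OF l] \<open>b m \<le> b l\<close> by auto
    obtain i j where ij: "i \<in> M" "j \<in> M" "i \<noteq> j" "x \<in> {a i..b i}" "x \<in> {a j..b j}"
      using M(2)[OF x] unfolding twice_covered_def by blast
    show ?thesis
    proof -
      \<comment> \<open>Renaming \<open>m\<close> to \<open>l\<close> is injective on
        \<open>M\<close> since \<open>l\<close> is not in \<open>M\<close>, so the two covering
        indices stay distinct.\<close>
      let ?r = "\<lambda>k. if k = m then l else k"
      have "?r i \<in> M'" "?r j \<in> M'" "?r i \<noteq> ?r j"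
        using ij False unfolding M'_def by auto
      moreover have "x \<in> {a (?r i)..b (?r i)}" "x \<in> {a (?r j)..b (?r j)}"
        using ij repl by presburger+
      ultimately show ?thesis
        unfolding twice_covered_def by blast
    qed
  qed
  have "M' \<subseteq> L"
    using M(1) best_indexD(1)[OF l] unfolding M'_def by blast
  moreover have "card M' = card M"
    using \<open>finite M\<close> False m(1) unfolding M'_def
    by (simp add: card.insert_remove card_Diff_singleton) (metis Suc_pred card_gt_0_iff empty_iff)
  ultimately have "optimal_cover d L a b M'"
    using opt cov' unfolding optimal_cover_def feasible_cover_def by auto
  then show ?thesis
    using \<open>L1 \<subseteq> M'\<close> unfolding M'_def by blast
qed

section \<open>The loop invariant\<close>

text \<open>The index \<open>p\<close> is the only one in \<open>L1\<close> that may reach beyond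
  \<open>c\<close>. The bound \<open>a p \<le> c\<close> makes it cover everything from
  \<open>c\<close> to \<open>c1\<close>, so one further interval restores double coverage
  there.\<close>

definition loop_inv ::
  "real \<Rightarrow> 'l set \<Rightarrow> ('l \<Rightarrow> real) \<Rightarrow> ('l \<Rightarrow> real) \<Rightarrow> 'l set \<Rightarrow> 'l set \<Rightarrow> real \<Rightarrow> real \<Rightarrow> bool" where
  "loop_inv d L a b I L1 c c1 \<longleftrightarrow>
     I = L - L1 \<and> 0 \<le> c \<and> c \<le> c1 \<and>
     (\<forall>x\<in>{0..c}. twice_covered a b L1 x) \<and>
     (\<exists>p\<in>L1. b p = c1 \<and> a p \<le> c \<and> (\<forall>l\<in>L1 - {p}. b l \<le> c)) \<and>
     (\<exists>M. optimal_cover d L a b M \<and> L1 \<subseteq> M)"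

text \<open>With \<open>False\<close> at \<open>Infeasible\<close>, preservation of the invariant
  also rules out the failing exit.\<close>

fun config_inv ::
  "real \<Rightarrow> 'l set \<Rightarrow> ('l \<Rightarrow> real) \<Rightarrow> ('l \<Rightarrow> real) \<Rightarrow> 'l config \<Rightarrow> bool" where
  "config_inv d L a b Start \<longleftrightarrow> True"
| "config_inv d L a b (Loop I L1 c c1) \<longleftrightarrow> loop_inv d L a b I L1 c c1"
| "config_inv d L a b (Output L1) \<longleftrightarrow> optimal_cover d L a b L1"
| "config_inv d L a b Infeasible \<longleftrightarrow> False"

text \<open>The offsets make the first step and the exit from the loop strictly decreasing, the
  latter even when \<open>I\<close> is empty.\<close>

fun config_size :: "'l set \<Rightarrow> 'l config \<Rightarrow> nat" where
  "config_size L Start = card L + 2"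
| "config_size L (Loop I L1 c c1) = card I + 1"
| "config_size L (Output L1) = 0"
| "config_size L Infeasible = 0"

text \<open>Two exchanges at \<open>c = 0\<close>: first for \<open>p\<close> over the empty set,
  then for \<open>q\<close> over \<open>{p}\<close>.\<close>

lemma loop_inv_init:
  assumes "finite L" "feasible_instance d L a b" "0 < d"
    and p: "best_index a b L 0 p" and q: "best_index a b (L - {p}) 0 q"
  shows "loop_inv d L a b (L - {p, q}) {p, q} (min (b p) (b q)) (max (b p) (b q))"
proof -
  have cover0: "twice_covered a b M 0" if "optimal_cover d L a b M" for M
    using that \<open>0 < d\<close> unfolding optimal_cover_def feasible_cover_def by auto
  obtain M0 where M0: "optimal_cover d L a b M0"
    using optimal_cover_exists assms(2) by blast
  obtain m0 where "m0 \<in> M0" "0 \<in> {a m0..b m0}"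
    using cover0[OF M0] by (auto simp: twice_covered_def)
  with p optimal_cover_exchange[OF \<open>finite L\<close> M0, of "{}" 0 p m0]
  obtain M1 where M1: "optimal_cover d L a b M1" "p \<in> M1"
    by auto
  obtain m1 where "m1 \<in> M1" "m1 \<noteq> p" "0 \<in> {a m1..b m1}"
    using cover0[OF M1(1)] by (rule twice_coveredE_other)
  with q M1 optimal_cover_exchange[OF \<open>finite L\<close> M1(1), of "{p}" 0 q m1]
  obtain M2 where M2: "optimal_cover d L a b M2" "{p, q} \<subseteq> M2"
    by auto
  have pq: "p \<noteq> q" "a p \<le> 0" "0 \<le> b p" "a q \<le> 0" "0 \<le> b q" "b q \<le> b p"
    using best_indexD[OF p] best_indexD[OF q] by auto
  then have "\<forall>x\<in>{0..b q}. twice_covered a b {p, q} x"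
    unfolding twice_covered_def by auto
  moreover have "\<exists>r\<in>{p, q}. b r = b p \<and> a r \<le> b q \<and> (\<forall>l\<in>{p, q} - {r}. b l \<le> b q)"
    using pq by (intro bexI[of _ p]) auto
  ultimately show ?thesis
    using pq M2 unfolding loop_inv_def by (auto simp: min_def max_def)
qed

text \<open>An interval of \<open>M\<close> other than \<open>p\<close> passes through
  \<open>c\<close> and ends beyond it, whereas all of \<open>L1\<close> except \<open>p\<close> ends
  by \<open>c\<close>. This supplies the interval to be exchanged and contradicts a failing
  step.\<close>

lemma loop_inv_unused_exists:
  assumes "finite L" "loop_inv d L a b I L1 c c1" "c < d"
    and "optimal_cover d L a b M"
  obtains m where "m \<in> M" "m \<in> I" "c \<in> {a m..b m}"
proof -
  obtain p where p: "\<forall>l\<in>L1 - {p}. b l \<le> c"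
    using assms(2) unfolding loop_inv_def by blast
  have M: "M \<subseteq> L" "\<forall>x\<in>{0..d}. twice_covered a b M x"
    using assms(4) unfolding optimal_cover_def feasible_cover_def by auto
  have I: "I = L - L1" "0 \<le> c"
    using assms(2) unfolding loop_inv_def by blast+
  have "finite M"
    using M(1) assms(1) by (rule finite_subset)
  then obtain m where m: "m \<in> M" "m \<noteq> p" "c \<in> {a m..b m}" "c < b m"
    using twice_covered_beyond[of M d a b c p] M(2) I(2) assms(3) by metis
  then have "m \<notin> L1"
    using p by force
  with m M(1) I(1) show ?thesis
    by (intro that[of m]) blast+
qed

lemma loop_inv_extend:
  assumes "finite L" and inv: "loop_inv d L a b I L1 c c1" and "c < d"
    and l: "best_index a b I c l"
  shows "loop_inv d L a b (I - {l}) (L1 \<union> {l}) (min c1 (b l)) (max c1 (b l))"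
proof -
  obtain p M where I: "I = L - L1" and c: "0 \<le> c" "c \<le> c1"
    and cov: "\<forall>x\<in>{0..c}. twice_covered a b L1 x"
    and p: "p \<in> L1" "b p = c1" "a p \<le> c" "\<forall>k\<in>L1 - {p}. b k \<le> c"
    and M: "optimal_cover d L a b M" "L1 \<subseteq> M"
    using inv unfolding loop_inv_def by blast
  obtain m where m: "m \<in> M" "m \<in> I" "c \<in> {a m..b m}"
    by (rule loop_inv_unused_exists[OF assms(1-3) M(1)])
  obtain M' where M': "optimal_cover d L a b M'" "insert l L1 \<subseteq> M'"
    using optimal_cover_exchange[OF \<open>finite L\<close> M, of c l m] cov l m I by auto
  have l': "l \<notin> L1" "a l \<le> c" "c \<le> b l"
    using best_indexD[OF l] I by auto
  have "twice_covered a b (L1 \<union> {l}) x" if "x \<in> {0..min c1 (b l)}" for x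
  proof (cases "x \<le> c")
    case True
    with cov that show ?thesis
      by (auto intro: twice_covered_mono[of _ _ L1])
  next
    case False
    \<comment> \<open>Beyond \<open>c\<close>, the old long interval \<open>p\<close> and the new
      \<open>l\<close> form the covering pair.\<close>
    with that p l' have "x \<in> {a p..b p}" "x \<in> {a l..b l}" "p \<noteq> l"
      by auto
    with p(1) show ?thesis
      unfolding twice_covered_def by blast
  qed
  \<comment> \<open>Whichever of \<open>p\<close> and \<open>l\<close> ends later takes over the
    role of \<open>p\<close>; the other ends exactly at the new \<open>c\<close>.\<close>
  moreover have "\<exists>r\<in>L1 \<union> {l}. b r = max c1 (b l) \<and> a r \<le> min c1 (b l) \<and>
      (\<forall>k\<in>L1 \<union> {l} - {r}. b k \<le> min c1 (b l))"
  proof (cases "b l \<le> c1")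
    case True
    with p l' show ?thesis
      by (intro bexI[of _ p]) force+
  next
    case False
    with p l' c show ?thesis
      by (intro bexI[of _ l]) force+
  qed
  ultimately show ?thesis
    using M' c l' I unfolding loop_inv_def by (auto simp: max_def)
qed

text \<open>Here \<open>L1\<close> is itself feasible, and it is no larger than the optimal cover
  containing it.\<close>

lemma optimal_cover_finish:
  assumes "finite L" "loop_inv d L a b I L1 c c1" "\<not> c < d"
  shows "optimal_cover d L a b L1"
proof -
  obtain M where M: "optimal_cover d L a b M" "L1 \<subseteq> M"
    using assms(2) unfolding loop_inv_def by blast
  then have "M \<subseteq> L"
    unfolding optimal_cover_def feasible_cover_def by blast
  with M(2) assms(1) have "card L1 \<le> card M"
    by (meson card_mono finite_subset)
  moreover have "feasible_cover d L a b L1"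
    using assms M(2) \<open>M \<subseteq> L\<close> unfolding feasible_cover_def loop_inv_def by auto
  ultimately show ?thesis
    using M(1) unfolding optimal_cover_def by (meson le_trans)
qed

section \<open>Termination and stuck configurations\<close>

text \<open>Both claims are proved together: the decrease in the loop needs \<open>I\<close> finite,
  which comes from the invariant.\<close>

lemma config_inv_step:
  assumes "finite L" "feasible_instance d L a b" "0 < d"
    and "greedy_step d L a b s t" "config_inv d L a b s"
  shows "config_inv d L a b t \<and> config_size L t < config_size L s"
  using assms(4)
proof cases
  case (init p q)
  then show ?thesis
    using loop_inv_init[OF assms(1-3)] card_mono[OF assms(1), of "L - {p, q}"] by auto
next
  case (extend c I l L1 c1)
  then have inv: "loop_inv d L a b I L1 c c1"
    using assms(5) by simp
  then have "finite I"
    using assms(1) unfolding loop_inv_def by simp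
  then have "card (I - {l}) < card I"
    using best_indexD(1)[OF extend(4)] by (rule card_Diff1_less)
  then show ?thesis
    using loop_inv_extend[OF assms(1) inv] extend by simp
next
  case (fail c I L1 c1)
  then have inv: "loop_inv d L a b I L1 c c1"
    using assms(5) by simp
  then show ?thesis
    using loop_inv_unused_exists[OF assms(1) inv] fail optimal_cover_exists[OF assms(2)]
    by metis
next
  case (finish c I L1 c1)
  then show ?thesis
    using optimal_cover_finish assms(1,5) by auto
qed

text \<open>\<open>Start\<close> can move because double coverage of 0 leaves a candidate after
  \<open>p\<close> is removed. A loop state can always extend, fail or finish, as a finite nonempty
  set of candidates has a best one.\<close>

lemma config_inv_stuck:
  assumes "finite L" "feasible_instance d L a b" "0 < d"
    and "config_inv d L a b s" "\<not> (\<exists>t. greedy_step d L a b s t)"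
  shows "\<exists>L1. s = Output L1 \<and> optimal_cover d L a b L1"
proof (cases s)
  case Start
  obtain M where "M \<subseteq> L" "twice_covered a b M 0"
    using assms(2,3) unfolding feasible_instance_def feasible_cover_def by auto
  then have cov: "twice_covered a b L 0"
    using twice_covered_mono by blast
  then obtain p where p: "best_index a b L 0 p"
    using best_index_exists[OF assms(1), of _ 0 a b] unfolding twice_covered_def by blast
  obtain m where "m \<in> L" "m \<noteq> p" "0 \<in> {a m..b m}"
    using cov by (rule twice_coveredE_other)
  then obtain q where "best_index a b (L - {p}) 0 q"
    using best_index_exists[of "L - {p}" m 0 a b] assms(1) by auto
  with p Start assms(5) show ?thesis
    using greedy_step.init by metis
next
  case (Loop I L1 c c1)
  have "finite I"
    using assms(1,4) Loop by (simp add: loop_inv_def)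
  with Loop assms(5) show ?thesis
    using greedy_step.extend greedy_step.fail greedy_step.finish best_index_exists by metis
qed (use assms(4) in auto)

theorem proposition1:
  fixes d :: real and L :: "'l set" and a b :: "'l \<Rightarrow> real"
  assumes "d > 0" and "finite L" and "feasible_instance d L a b"
  shows "greedy_terminates_with d L a b (optimal_cover d L a b)"
  unfolding greedy_terminates_with_def
proof (intro conjI allI impI)
  note step = config_inv_step[OF assms(2,3,1)]
  show "\<not> (\<exists>r :: nat \<Rightarrow> 'l config. r 0 = Start \<and> (\<forall>i. greedy_step d L a b (r i) (r (Suc i))))"
  proof
    assume "\<exists>r :: nat \<Rightarrow> 'l config. r 0 = Start \<and> (\<forall>i. greedy_step d L a b (r i) (r (Suc i)))"
    then obtain r :: "nat \<Rightarrow> 'l config"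
      where r: "r 0 = Start" "\<And>i. greedy_step d L a b (r i) (r (Suc i))"
      by blast
    \<comment> \<open>The invariant is established along the whole run because the decrease of
      \<open>config_size\<close> is known only under it.\<close>
    have "config_inv d L a b (r i)" for i
      by (induction i) (use r step in auto)
    then have "(r (Suc i), r i) \<in> measure (config_size L)" for i
      using step r(2) by simp
    then show False
      using wf_measure[of "config_size L"] unfolding wf_iff_no_infinite_down_chain by blast
  qed
  fix s
  assume s: "(greedy_step d L a b)\<^sup>*\<^sup>* Start s \<and> \<not> (\<exists>t. greedy_step d L a b s t)"
  then have "(greedy_step d L a b)\<^sup>*\<^sup>* Start s" by blast
  then have "config_inv d L a b s"
    by induction (use step in auto)
  then show "\<exists>L1. s = Output L1 \<and> optimal_cover d L a b L1"
    using config_inv_stuck[OF assms(2,3,1)] s by blast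
qed

end
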